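(* Let $0<\alpha<1$ and let $\bar V>\max_iy_i^m$ be fixed. Let $S^*=\{s_i\in S:\ s_i\in\arg\max_{s_j\in S}y_j^m\}$. For each city $s_i\in S\setminus S^*$, let $S_i^*=\{s_k\in S:\ y_k^m>y_i^m\}$ denote the nonempty set of cities with higher values of urban productivity than city $s_i$. Then, for the weights $\lambda$ (depending on $\delta>0$) described in the context, there exists $\delta_i^*$ such that $s_i\in T(\lambda)$ if and only if $\delta>\delta_i^*$, with $$\delta_i^*:=\left(\frac{1-\alpha}{\alpha}\right)\max_{s_j\in S_i^*}\frac{1}{d_j(s_i)}\log\left(\frac{\bar V^{\frac{\alpha}{1-\alpha}}-(y_i^m)^{\frac{\alpha}{1-\alpha}}}{\bar V^{\frac{\alpha}{1-\alpha}}-(y_j^m)^{\frac{\alpha}{1-\alpha}}}\right).$$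
   Context: $X\subset\mathbb{R}^2$ is open, bounded, connected, with Lipschitz boundary; $S=\{s_1,\dots,s_n\}\subset X$ is a finite set of potential urban sites with urban productivities $y_i^m>0$; $d_i=d_{s_i}:\mathbb{R}^2\to[0,\infty)$ are continuous distance functions with $d_i(s_i)=0$. For $s\ne t\in S$ and $\gamma\in\mathbb{R}$, put $R_\gamma(s,t)=\{x\in\mathbb{R}^2: d_s(x)-d_t(x)<\gamma\}$. The system $(d_s)_{s\in S}$ is assumed admissible: for all $s\neq t\in S$ and each bounded open $C\subset\mathbb{R}^2$ there are constants $m_{st}<M_{st}$ such that $\gamma\mapsto|C\cap R_\gamma(s,t)|$ (Lebesgue measure) is continuously increasing from $0$ to $|C|$ as $\gamma$ grows from $m_{st}$ to $M_{st}$, with $C\cap R_\gamma(s,t)=\emptyset$ if $\gamma\le m_{st}$ and $C\subset R_\gamma(s,t)$ if $\gamma\ge M_{st}$. The additively weighted Voronoi regions are $\Omega_i(\lambda)=X\cap\bigcap_{j\ne i}R_{\lambda_i-\lambda_j}(s_i,s_j)$. In the equilibrium with mobile labor at welfare level $\bar V$ (shipping costs $\exp(\delta d_i(x))$), the weights, defined up to a common additive constant, satisfy $$\lambda_i-\lambda_j=\frac1\delta\,\frac{1-\alpha}{\alpha}\log\left(\frac{\bar V^{\frac{\alpha}{1-\alpha}}-(y_j^m)^{\frac{\alpha}{1-\alpha}}}{\bar V^{\frac{\alpha}{1-\alpha}}-(y_i^m)^{\frac{\alpha}{1-\alpha}}}\right),\qquad i,j=1,\dots,n.$$ The set of inhabited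 cities is $T(\lambda)=\{s_i\in S:\Omega_i(\lambda)\ne\emptyset\}$.
   Formalization: The distance functions are also assumed to satisfy d_j(s_i) > 0 for distinct sites and the triangle inequality d_j(x) ≤ d_j(s_i) + d_i(x); without it the claim fails, e.g. for squared Euclidean distances. *)

theory Defs
  imports "HOL-Analysis.Analysis"
begin

text \<open>Sites are points of the plane; families indexed by the sites are functions of the site,
  so \<open>d s x\<close> is the value at \<open>x\<close> of the distance function of the site \<open>s\<close>.\<close>

type_synonym plane = "real ^ 2"

text \<open>Near each boundary point \<open>p\<close>, in orthonormal coordinates \<open>(u, v)\<close> centred at \<open>p\<close>,
  the set is the strict subgraph of a Lipschitz function.\<close>

definition lipschitz_boundary :: "plane set \<Rightarrow> bool" where
  "lipschitz_boundary X \<longleftrightarrow>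
    (\<forall>p\<in>frontier X. \<exists>r>0. \<exists>u v g L. norm u = 1 \<and> norm v = 1 \<and> u \<bullet> v = 0 \<and>
       L-lipschitz_on (UNIV :: real set) g \<and>
       (\<forall>x\<in>ball p r. x \<in> X \<longleftrightarrow> (x - p) \<bullet> v < g ((x - p) \<bullet> u)))"

text \<open>Only the consequences of ``\<open>d s\<close> is the distance from \<open>s\<close>'' that involve the sites are
  required. In particular \<open>d\<close> may be asymmetric, and may come from a metric
  (lemma \<open>distance_functions_metric\<close>). The triangle inequality is what separates distances from
  e.g. squared Euclidean distances, whose Voronoi regions need not contain their sites.\<close>

definition distance_functions :: "plane set \<Rightarrow> (plane \<Rightarrow> plane \<Rightarrow> real) \<Rightarrow> bool" where
  "distance_functions S d \<longleftrightarrow>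
    (\<forall>s\<in>S. continuous_on UNIV (d s) \<and> (\<forall>x. 0 \<le> d s x) \<and> d s s = 0) \<and>
    (\<forall>s\<in>S. \<forall>t\<in>S. s \<noteq> t \<longrightarrow> 0 < d t s) \<and>
    (\<forall>s\<in>S. \<forall>t\<in>S. \<forall>x. d t x \<le> d t s + d s x)"

lemma distance_functions_metric:
  assumes "Metric_space UNIV D" and "\<And>s. s \<in> S \<Longrightarrow> continuous_on UNIV (D s)"
  shows "distance_functions S D"
proof -
  interpret Metric_space UNIV D by fact
  show ?thesis
    unfolding distance_functions_def using assms(2) triangle by auto
qed

definition R_region :: "(plane \<Rightarrow> plane \<Rightarrow> real) \<Rightarrow> real \<Rightarrow> plane \<Rightarrow> plane \<Rightarrow> plane set" where
  "R_region d \<gamma> s t = {x. d s x - d t x < \<gamma>}"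

definition admissible :: "plane set \<Rightarrow> (plane \<Rightarrow> plane \<Rightarrow> real) \<Rightarrow> bool" where
  "admissible S d \<longleftrightarrow>
    (\<forall>s\<in>S. \<forall>t\<in>S. s \<noteq> t \<longrightarrow> (\<forall>C. open C \<and> bounded C \<longrightarrow>
      (\<exists>m M. m < M \<and>
        (let f = (\<lambda>\<gamma>. measure lebesgue (C \<inter> R_region d \<gamma> s t)) in
           continuous_on {m..M} f \<and> mono_on {m..M} f \<and> f m = 0 \<and> f M = measure lebesgue C) \<and>
        (\<forall>\<gamma>\<le>m. C \<inter> R_region d \<gamma> s t = {}) \<and>
        (\<forall>\<gamma>\<ge>M. C \<subseteq> R_region d \<gamma> s t))))"

definition voronoi_region ::
  "plane set \<Rightarrow> plane set \<Rightarrow> (plane \<Rightarrow> plane \<Rightarrow> real) \<Rightarrow> (plane \<Rightarrow> real) \<Rightarrow> plane \<Rightarrow> plane set" where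
  "voronoi_region X S d w s = X \<inter> (\<Inter>t\<in>S - {s}. R_region d (w s - w t) s t)"

definition inhabited ::
  "plane set \<Rightarrow> plane set \<Rightarrow> (plane \<Rightarrow> plane \<Rightarrow> real) \<Rightarrow> (plane \<Rightarrow> real) \<Rightarrow> plane set" where
  "inhabited X S d w = {s \<in> S. voronoi_region X S d w s \<noteq> {}}"

definition equilibrium_weights ::
  "plane set \<Rightarrow> (plane \<Rightarrow> real) \<Rightarrow> real \<Rightarrow> real \<Rightarrow> real \<Rightarrow> (plane \<Rightarrow> real) \<Rightarrow> bool" where
  "equilibrium_weights S y \<alpha> V \<delta> w \<longleftrightarrow>
    (\<forall>s\<in>S. \<forall>t\<in>S. w s - w t =
      1 / \<delta> * ((1 - \<alpha>) / \<alpha>) *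
        ln ((V powr (\<alpha> / (1 - \<alpha>)) - y t powr (\<alpha> / (1 - \<alpha>))) /
            (V powr (\<alpha> / (1 - \<alpha>)) - y s powr (\<alpha> / (1 - \<alpha>)))))"

definition most_productive :: "plane set \<Rightarrow> (plane \<Rightarrow> real) \<Rightarrow> plane set" where
  "most_productive S y = {s. is_arg_max y (\<lambda>t. t \<in> S) s}"

definition more_productive :: "plane set \<Rightarrow> (plane \<Rightarrow> real) \<Rightarrow> plane \<Rightarrow> plane set" where
  "more_productive S y s = {t \<in> S. y t > y s}"

end

(* By the triangle inequality, x \<mapsto> d s x - d t x attains its minimum - d t s at x = s, for all t
   simultaneously. Hence the region of s is nonempty iff it contains s itself, that is, iff
   w t - w s < d t s for every other site t. For sites that are not more productive this is
   automatic, because w t \<le> w s; for more productive ones it can be solved for \<delta>. *)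

theory Submission
  imports Defs
begin

text \<open>Trades the search for a point of \<open>X\<close> for one inequality between weights per
  rival site, so that the shape of \<open>X\<close> drops out. The site itself is the test point,
  available because \<open>S \<subseteq> X\<close>.\<close>

lemma inhabited_iff:
  assumes "S \<subseteq> X" and "distance_functions S d" and "s \<in> S"
  shows "s \<in> inhabited X S d w \<longleftrightarrow> (\<forall>t\<in>S - {s}. w t - w s < d t s)"
proof
  assume "s \<in> inhabited X S d w"
  then obtain x where x: "\<And>t. t \<in> S - {s} \<Longrightarrow> d s x - d t x < w s - w t"
    by (auto simp: inhabited_def voronoi_region_def R_region_def)
  show "\<forall>t\<in>S - {s}. w t - w s < d t s"
  proof
    \<comment> \<open>The detour runs from \<open>t\<close> via \<open>s\<close> to
      \<open>x\<close>; the order of arguments matters because \<open>d\<close> may be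
      asymmetric.\<close>
    fix t assume t: "t \<in> S - {s}"
    have "d t x \<le> d t s + d s x"
      using assms(2,3) t by (auto simp: distance_functions_def)
    with x[OF t] show "w t - w s < d t s" by linarith
  qed
next
  assume *: "\<forall>t\<in>S - {s}. w t - w s < d t s"
  have "d s s = 0"
    using assms(2,3) by (auto simp: distance_functions_def)
  then have "d s s - d t s < w s - w t" if "t \<in> S - {s}" for t
    using *[rule_format, OF that] by linarith
  then have "s \<in> voronoi_region X S d w s"
    using assms(1,3) by (auto simp: voronoi_region_def R_region_def)
  then show "s \<in> inhabited X S d w"
    using assms(3) by (auto simp: inhabited_def)
qed

text \<open>Guarantees that the \<open>Max\<close> in the threshold is taken over a nonempty set,
  where its value is meaningful.\<close>

lemma more_productive_nonempty:
  assumes "s \<in> S - most_productive S y"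
  shows "more_productive S y s \<noteq> {}"
  using assms by (auto simp: most_productive_def more_productive_def is_arg_max_def)

theorem lemma5p4:
  fixes X S :: "plane set"
    and d :: "plane \<Rightarrow> plane \<Rightarrow> real"
    and y :: "plane \<Rightarrow> real"
    and \<alpha> V :: real
    and s :: plane
  assumes "open X" and "bounded X" and "connected X" and "lipschitz_boundary X"
    and "finite S" and "S \<subseteq> X"
    and "\<And>t. t \<in> S \<Longrightarrow> 0 < y t"
    and "distance_functions S d"
    and "admissible S d"
    and "0 < \<alpha>" and "\<alpha> < 1"
    and "V > Max (y ` S)"
    and "s \<in> S - most_productive S y"
  shows "more_productive S y s \<noteq> {} \<and>
    (\<exists>\<delta>star. \<delta>star = (1 - \<alpha>) / \<alpha> *
        Max ((\<lambda>t. 1 / d t s *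
          ln ((V powr (\<alpha> / (1 - \<alpha>)) - y s powr (\<alpha> / (1 - \<alpha>))) /
              (V powr (\<alpha> / (1 - \<alpha>)) - y t powr (\<alpha> / (1 - \<alpha>))))) ` more_productive S y s) \<and>
      (\<forall>\<delta>>0. \<forall>w. equilibrium_weights S y \<alpha> V \<delta> w \<longrightarrow>
        (s \<in> inhabited X S d w \<longleftrightarrow> \<delta> > \<delta>star)))"
proof -
  define c where "c = (1 - \<alpha>) / \<alpha>"
  \<comment> \<open>Since the exponent is positive, \<open>A t\<close> is positive for sites and
    shrinks as productivity grows; these two facts determine the sign of the logarithms
    below.\<close>
  define A where "A t = V powr (\<alpha> / (1 - \<alpha>)) - y t powr (\<alpha> / (1 - \<alpha>))" for t
  define M where "M = more_productive S y s"
  have s: "s \<in> S" using assms(13) by simp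
  have c: "0 < c" using assms(10,11) by (simp add: c_def)
  have b: "0 < \<alpha> / (1 - \<alpha>)" using assms(10,11) by simp
  have V: "y t < V" if "t \<in> S" for t
    using assms(5,12) that by (meson Max_ge finite_imageI imageI le_less_trans)
  have A_pos: "0 < A t" if "t \<in> S" for t
    using powr_less_mono2[OF b _ V[OF that]] assms(7)[OF that] by (simp add: A_def)
  have A_mono: "A s \<le> A t" if "t \<in> S" "y t \<le> y s" for t
    using powr_mono2[OF _ _ that(2), of "\<alpha> / (1 - \<alpha>)"] b assms(7)[OF that(1)] by (simp add: A_def)
  have dpos: "0 < d t s" if "t \<in> S - {s}" for t
    using assms(8) s that by (auto simp: distance_functions_def)
  have fin: "finite M" and MS: "M \<subseteq> S - {s}"
    using assms(5) by (auto simp: M_def more_productive_def)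
  have ne: "M \<noteq> {}"
    unfolding M_def using assms(13) by (rule more_productive_nonempty)
  have "s \<in> inhabited X S d w \<longleftrightarrow> c * Max ((\<lambda>t. 1 / d t s * ln (A s / A t)) ` M) < \<delta>"
    if \<delta>: "0 < \<delta>" and "equilibrium_weights S y \<alpha> V \<delta> w" for \<delta> w
  proof -
    \<comment> \<open>The weight equation is used with the two sites exchanged, which puts
      \<open>A s\<close> in the numerator.\<close>
    have w: "w t - w s = 1 / \<delta> * c * ln (A s / A t)" if "t \<in> S" for t
      using \<open>equilibrium_weights S y \<alpha> V \<delta> w\<close> that s
      unfolding equilibrium_weights_def c_def A_def by blast
    \<comment> \<open>Ties \<open>y t = y s\<close> belong here: the weights then agree, and
      strictness comes from \<open>0 < d t s\<close>.\<close>
    have less_productive: "w t - w s < d t s" if "t \<in> S - {s} - M" for t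
    proof -
      have t: "t \<in> S" "y t \<le> y s"
        using that by (auto simp: M_def more_productive_def)
      have "ln (A s / A t) \<le> 0"
        using A_mono[OF t] A_pos[OF t(1)] A_pos[OF s] by simp
      then have "w t - w s \<le> 0"
        unfolding w[OF t(1)] using c \<delta> by (intro mult_nonneg_nonpos) auto
      with dpos[of t] that show ?thesis by simp
    qed
    \<comment> \<open>The factors \<open>\<delta>\<close>, \<open>c\<close> and \<open>d t s\<close>
      are positive, so the strict inequality can be rearranged until its right side is free of
      \<open>t\<close>; the conditions over \<open>M\<close> then merge into one bound on a
      maximum.\<close>
    have solve: "w t - w s < d t s \<longleftrightarrow> 1 / d t s * ln (A s / A t) < \<delta> / c"
      if "t \<in> M" for t
    proof -
      have t: "t \<in> S" "0 < d t s" using that MS dpos by auto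
      show ?thesis
        unfolding w[OF t(1)] using t(2) c \<delta> by (simp add: field_simps)
    qed
    have "s \<in> inhabited X S d w \<longleftrightarrow> (\<forall>t\<in>S - {s}. w t - w s < d t s)"
      by (rule inhabited_iff[OF assms(6,8) s])
    also have "\<dots> \<longleftrightarrow> (\<forall>t\<in>M. w t - w s < d t s)"
      using less_productive MS by blast
    also have "\<dots> \<longleftrightarrow> Max ((\<lambda>t. 1 / d t s * ln (A s / A t)) ` M) < \<delta> / c"
      using fin ne by (subst Max_less_iff) (auto simp: solve)
    also have "\<dots> \<longleftrightarrow> c * Max ((\<lambda>t. 1 / d t s * ln (A s / A t)) ` M) < \<delta>"
      using c by (simp add: pos_less_divide_eq mult.commute)
    finally show ?thesis .
  qed
  with ne show ?thesis
    unfolding M_def A_def c_def by blast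
qed

end
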